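(* Let $\mathcal{H}$ be a real Hilbert space, let $\rho>0$, and let $\phi:\mathcal{H}\to(-\infty,+\infty]$ be such that $\check{\phi}:=\phi+\frac{\rho}{2}\|\cdot\|^2\in\Gamma_0(\mathcal{H})$. Then, for every $\sigma>0$, $$\mathrm{s\text{-}Prox}_{\check{\phi}/\sigma}=\mathrm{s\text{-}Prox}_{\phi/(\sigma+\rho)}\circ\Big(\frac{\sigma}{\sigma+\rho}\mathrm{Id}\Big),$$ $$\mathrm{Id}=\mathrm{s\text{-}Prox}_{\sigma\check{\phi}^{*}}+\sigma\,\mathrm{s\text{-}Prox}_{\phi/(\sigma+\rho)}\circ(\sigma+\rho)^{-1}\mathrm{Id}.$$
   Context: $\Gamma_0(\mathcal{H})$ is the set of proper lower semicontinuous convex functions $\mathcal{H}\to(-\infty,+\infty]$. $\mathrm{Id}$ is the identity operator on $\mathcal{H}$. For a proper function $f:\mathcal{H}\to(-\infty,+\infty]$ such that $f+\frac12\|x-\cdot\|^2$ has a unique minimizer for every $x\in\mathcal{H}$, the single-valued proximity operator is $\mathrm{s\text{-}Prox}_f(x):=\operatorname{argmin}_{y\in\mathcal{H}}\big(f(y)+\frac12\|x-y\|^2\big)$; for $f\in\Gamma_0(\mathcal{H})$ this is Moreau's classical proximity operator. The Fenchel conjugate is $f^*(x):=\sup_{y\in\mathcal{H}}[\langle x,y\rangle-f(y)]$. *)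

theory Defs
  imports "HOL-Analysis.Analysis"
begin

text \<open>
  Functions with values in \<open>(-\<infinity>, +\<infinity>]\<close> are functions into \<^typ>\<open>ereal\<close> that never take the
  value \<open>-\<infinity>\<close>. The sort \<open>{real_inner, complete_space}\<close> is that of real Hilbert spaces.
\<close>

definition proper_fun :: "('a \<Rightarrow> ereal) \<Rightarrow> bool" where
  "proper_fun f \<longleftrightarrow> (\<forall>x. f x \<noteq> -\<infinity>) \<and> (\<exists>x. f x \<noteq> \<infinity>)"

definition lsc_fun :: "('a::topological_space \<Rightarrow> ereal) \<Rightarrow> bool" where
  "lsc_fun f \<longleftrightarrow> (\<forall>x. f x \<le> Liminf (nhds x) f)"

text \<open>The weights are kept strictly positive so that the product \<open>0 * \<infinity>\<close> never arises.\<close>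

definition convex_fun :: "('a::real_vector \<Rightarrow> ereal) \<Rightarrow> bool" where
  "convex_fun f \<longleftrightarrow>
     (\<forall>x y. \<forall>u>0. \<forall>v>0. u + v = 1 \<longrightarrow>
        f (u *\<^sub>R x + v *\<^sub>R y) \<le> ereal u * f x + ereal v * f y)"

definition Gamma0 :: "('a::{real_inner,complete_space} \<Rightarrow> ereal) set" where
  "Gamma0 = {f. proper_fun f \<and> lsc_fun f \<and> convex_fun f}"

definition fenchel_conjugate :: "('a::real_inner \<Rightarrow> ereal) \<Rightarrow> 'a \<Rightarrow> ereal" where
  "fenchel_conjugate f x = (SUP y. ereal (x \<bullet> y) - f y)"

definition is_prox_point :: "('a::real_inner \<Rightarrow> ereal) \<Rightarrow> 'a \<Rightarrow> 'a \<Rightarrow> bool" where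
  "is_prox_point f x y \<longleftrightarrow> is_arg_min (\<lambda>z. f z + ereal (1/2 * (norm (x - z))\<^sup>2)) (\<lambda>_. True) y"

text \<open>The value of \<open>sprox f\<close> is meaningful only for functions satisfying \<open>has_sprox\<close>.\<close>

definition has_sprox :: "('a::real_inner \<Rightarrow> ereal) \<Rightarrow> bool" where
  "has_sprox f \<longleftrightarrow> proper_fun f \<and> (\<forall>x. \<exists>!y. is_prox_point f x y)"

definition sprox :: "('a::real_inner \<Rightarrow> ereal) \<Rightarrow> 'a \<Rightarrow> 'a" where
  "sprox f x = (THE y. is_prox_point f x y)"

definition add_quadratic :: "real \<Rightarrow> ('a::real_inner \<Rightarrow> ereal) \<Rightarrow> 'a \<Rightarrow> ereal" where
  "add_quadratic \<rho> f x = f x + ereal (\<rho> / 2 * (norm x)\<^sup>2)"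

end

theory Submission
  imports Defs
begin

text \<open>
  Write \<open>g = \<phi> + \<rho>/2 \<parallel>\<cdot>\<parallel>\<^sup>2\<close>. The first identity is completion of the square: the objective
  \<open>g z / \<sigma> + 1/2 \<parallel>x - z\<parallel>\<^sup>2\<close> equals, up to the positive factor \<open>(\<sigma> + \<rho>)/\<sigma>\<close> and a constant
  independent of \<open>z\<close>, the objective \<open>\<phi> z / (\<sigma> + \<rho>) + 1/2 \<parallel>\<sigma>/(\<sigma> + \<rho>) x - z\<parallel>\<^sup>2\<close>. So the two
  problems have the same minimizers (\<open>is_prox_point_add_quadratic\<close>), and since
  \<open>x \<mapsto> \<sigma>/(\<sigma> + \<rho>) x\<close> is onto, unique solvability for the convex function \<open>g / \<sigma>\<close> at every
  point passes to \<open>\<phi> / (\<sigma> + \<rho>)\<close>, although \<open>\<phi>\<close> itself may fail to be convex.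

  The second identity is Moreau's decomposition of \<open>x\<close> for \<open>g\<close>, rewritten with the first one at
  the point \<open>x / \<sigma>\<close>. If \<open>p\<close> is the proximal point of \<open>g / \<sigma>\<close> at \<open>x / \<sigma>\<close>, then
  \<open>q = x - \<sigma> p\<close> is a subgradient of \<open>g\<close> at \<open>p\<close>, so the Fenchel conjugate of \<open>g\<close> is finite at
  \<open>q\<close> and has the affine minorant of slope \<open>p\<close> that touches it there. Adding this minorant to the
  quadratic term shows that \<open>q\<close> is the only minimizer of the proximal objective of the scaled
  conjugate (\<open>prox_point_fenchel_conjugate\<close>).

  What remains is that functions in \<open>\<Gamma>\<^sub>0\<close> have proximal points (\<open>Gamma0_has_sprox\<close>). Lower
  semicontinuity at one point together with convexity bounds the function below by a downward
  cone, so that the objective is bounded below; by strong convexity its minimizing sequences are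
  Cauchy, and by completeness and lower semicontinuity they converge to a minimizer.
\<close>

section \<open>Lower semicontinuity and scaling\<close>

lemma lsc_fun_eventually:
  assumes "lsc_fun f" "c < f x"
  shows "eventually (\<lambda>z. c < f z) (nhds x)"
proof -
  have "c < Liminf (nhds x) f"
    using assms unfolding lsc_fun_def by (meson less_le_trans)
  then show ?thesis by (rule less_LiminfD)
qed

text \<open>Real levels suffice, which keeps the infinite values out of the verifications below.\<close>

lemma lsc_funI:
  fixes f :: "'a::topological_space \<Rightarrow> ereal"
  assumes "\<And>x c. ereal c < f x \<Longrightarrow> eventually (\<lambda>z. ereal c < f z) (nhds x)"
  shows "lsc_fun f"
  unfolding lsc_fun_def le_Liminf_iff
proof (intro allI impI)
  fix x y assume "y < f x"
  then obtain c where c: "y < ereal c" "ereal c < f x"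
    using ereal_dense2 by blast
  show "eventually (\<lambda>z. y < f z) (nhds x)"
    using assms[OF c(2)] by eventually_elim (use c(1) in order)
qed

lemma lsc_fun_add_continuous:
  fixes f :: "'a::topological_space \<Rightarrow> ereal" and h :: "'a \<Rightarrow> real"
  assumes "lsc_fun f" "continuous_on UNIV h"
  shows "lsc_fun (\<lambda>x. f x + ereal (h x))"
proof (rule lsc_funI)
  fix x c assume "ereal c < f x + ereal (h x)"
  then have "ereal (c - h x) < f x" by (cases "f x") auto
  \<comment> \<open>Split the level \<open>c\<close> as \<open>d + (c - d)\<close>, strictly below the two summands at \<open>x\<close>.\<close>
  then obtain d where d: "ereal (c - h x) < ereal d" "ereal d < f x"
    using ereal_dense2 by blast
  have "(h \<longlongrightarrow> h x) (nhds x)"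
    using assms(2) by (simp add: continuous_on_def tendsto_at_iff_tendsto_nhds)
  then have "eventually (\<lambda>z. c - d < h z) (nhds x)"
    using d(1) by (auto simp: order_tendsto_iff)
  with lsc_fun_eventually[OF assms(1) d(2)]
  show "eventually (\<lambda>z. ereal c < f z + ereal (h z)) (nhds x)"
  proof eventually_elim
    case (elim z)
    then show ?case by (cases "f z") auto
  qed
qed

lemma Gamma0_divide:
  assumes g: "g \<in> Gamma0" and s: "(s::real) > 0"
  shows "(\<lambda>x. g x / ereal s) \<in> Gamma0"
proof -
  have p: "proper_fun g" and l: "lsc_fun g" and c: "convex_fun g"
    using g by (auto simp: Gamma0_def)
  have "proper_fun (\<lambda>x. g x / ereal s)"
    using p s unfolding proper_fun_def
    by (auto simp: divide_ereal_def ereal_mult_eq_MInfty ereal_mult_eq_PInfty)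
  moreover have "lsc_fun (\<lambda>x. g x / ereal s)"
  proof (rule lsc_funI)
    fix x c assume "ereal c < g x / ereal s"
    then have "ereal (c * s) < g x" using s by (cases "g x") (auto simp: field_simps)
    from lsc_fun_eventually[OF l this]
    show "eventually (\<lambda>z. ereal c < g z / ereal s) (nhds x)"
    proof eventually_elim
      case (elim z)
      then show ?case using s by (cases "g z") (auto simp: field_simps)
    qed
  qed
  moreover have "convex_fun (\<lambda>x. g x / ereal s)"
    unfolding convex_fun_def
  proof (intro allI impI)
    fix x y :: 'a and u v :: real assume uv: "u > 0" "v > 0" "u + v = 1"
    have "g (u *\<^sub>R x + v *\<^sub>R y) \<le> ereal u * g x + ereal v * g y"
      using c uv unfolding convex_fun_def by blast
    moreover have "g x \<noteq> -\<infinity>" "g y \<noteq> -\<infinity>" "g (u *\<^sub>R x + v *\<^sub>R y) \<noteq> -\<infinity>"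
      using p by (auto simp: proper_fun_def)
    ultimately show "g (u *\<^sub>R x + v *\<^sub>R y) / ereal s
        \<le> ereal u * (g x / ereal s) + ereal v * (g y / ereal s)"
      using s uv
      by (cases "g x"; cases "g y"; cases "g (u *\<^sub>R x + v *\<^sub>R y)") (auto simp: field_simps)
  qed
  ultimately show ?thesis by (simp add: Gamma0_def)
qed

section \<open>Existence and uniqueness of proximal points\<close>

text \<open>
  Lower semicontinuity gives \<open>f \<ge> f x0 - 1\<close> on a ball of radius \<open>r\<close> around a point \<open>x0\<close> with
  \<open>f x0\<close> finite. A value far below this at a distant point \<open>y\<close> would, by convexity along the
  segment from \<open>x0\<close> to \<open>y\<close>, violate the bound inside the ball. The resulting minorant is a
  downward cone, which grows only linearly and is therefore dominated by a quadratic term.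
\<close>

lemma Gamma0_lower_bound:
  assumes "f \<in> Gamma0"
  obtains x0 a K where "K \<ge> 0" "\<And>y. ereal (a - K * norm (y - x0)) \<le> f y"
proof -
  have p: "proper_fun f" and l: "lsc_fun f" and c: "convex_fun f"
    using assms by (auto simp: Gamma0_def)
  obtain x0 b where b: "f x0 = ereal b"
    using p unfolding proper_fun_def by (metis ereal_cases)
  have "eventually (\<lambda>z. ereal (b - 1) < f z) (nhds x0)"
    by (rule lsc_fun_eventually[OF l]) (simp add: b)
  then obtain r where r: "r > 0" "\<And>z. dist z x0 < r \<Longrightarrow> ereal (b - 1) < f z"
    unfolding eventually_nhds_metric by blast
  have "ereal (b - 1 - (2 / r) * norm (y - x0)) \<le> f y" for y
  proof (cases "dist y x0 < r")
    case True
    have "ereal (b - 1 - (2 / r) * norm (y - x0)) \<le> ereal (b - 1)" using r(1) by simp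
    with r(2)[OF True] show ?thesis by order
  next
    case False
    \<comment> \<open>With this \<open>t\<close> the point \<open>(1 - t) x0 + t y\<close> lies at distance \<open>r / 2\<close> from \<open>x0\<close>.\<close>
    define t where "t = r / (2 * norm (y - x0))"
    have n: "norm (y - x0) \<ge> r" using False by (simp add: dist_norm)
    have "norm (y - x0) > 0" using n r(1) by linarith
    then have t: "0 < t" "t < 1" using n r(1) by (auto simp: t_def)
    have z: "(1 - t) *\<^sub>R x0 + t *\<^sub>R y - x0 = t *\<^sub>R (y - x0)" by (simp add: algebra_simps)
    have "dist ((1 - t) *\<^sub>R x0 + t *\<^sub>R y) x0 < r"
      unfolding dist_norm z using n r(1) by (simp add: t_def)
    then have "ereal (b - 1) < f ((1 - t) *\<^sub>R x0 + t *\<^sub>R y)" by (rule r(2))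
    also have "\<dots> \<le> ereal (1 - t) * f x0 + ereal t * f y"
      using c t unfolding convex_fun_def by simp
    finally have *: "ereal (b - 1) < ereal (1 - t) * f x0 + ereal t * f y" .
    show ?thesis
    proof (cases "f y")
      case (real w)
      with * b have "b - 1 < (1 - t) * b + t * w" by simp
      then have "t * (b - w) < 1" by (simp add: algebra_simps)
      then have "b - w < 1 / t" using t by (simp add: field_simps)
      also have "1 / t = (2 / r) * norm (y - x0)" by (simp add: t_def)
      finally show ?thesis using real by simp
    qed (use p in \<open>auto simp: proper_fun_def\<close>)
  qed
  with r(1) show ?thesis by (intro that[of "2 / r" "b - 1" x0]) auto
qed

text \<open>
  If \<open>a\<close> and \<open>b\<close> both come within \<open>e\<close> of the infimum, the value at their midpoint cannot fall
  below the infimum, which forces \<open>k \<parallel>a - b\<parallel>\<^sup>2 \<le> e\<close>. This one estimate makes minimizing sequences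
  Cauchy and, with \<open>e = 0\<close>, makes the minimizer unique.
\<close>

lemma ex1_minimizer_midpoint_strongly_convex:
  fixes F :: "'a::{real_inner,complete_space} \<Rightarrow> ereal"
  assumes pr: "proper_fun F" and l: "lsc_fun F" and bd: "\<And>x. ereal B \<le> F x"
    and k: "k > 0"
    and mid: "\<And>a b u v. F a = ereal u \<Longrightarrow> F b = ereal v \<Longrightarrow>
       F ((1/2) *\<^sub>R a + (1/2) *\<^sub>R b) \<le> ereal ((u + v) / 2 - k * (norm (a - b))\<^sup>2)"
  shows "\<exists>!y. \<forall>z. F y \<le> F z"
proof -
  obtain x0 where x0: "F x0 \<noteq> \<infinity>" using pr by (auto simp: proper_fun_def)
  have "ereal B \<le> (INF x. F x)" by (rule INF_greatest) (rule bd)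
  moreover have "(INF x. F x) \<le> F x0" by (rule INF_lower) simp
  ultimately obtain m where m: "(INF x. F x) = ereal m"
    using x0 by (cases "INF x. F x") auto
  have ml: "ereal m \<le> F z" for z unfolding m[symmetric] by (rule INF_lower) simp
  have close: "k * (norm (a - b))\<^sup>2 \<le> e"
    if a: "F a \<le> ereal (m + e)" and b: "F b \<le> ereal (m + e)" for a b e
  proof -
    obtain u where u: "F a = ereal u" "u \<le> m + e" using a ml[of a] by (cases "F a") auto
    obtain v where v: "F b = ereal v" "v \<le> m + e" using b ml[of b] by (cases "F b") auto
    have "ereal m \<le> ereal ((u + v) / 2 - k * (norm (a - b))\<^sup>2)"
      using ml mid[OF u(1) v(1)] by (rule order_trans)
    then have "m \<le> (u + v) / 2 - k * (norm (a - b))\<^sup>2" by simp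
    then show ?thesis using u(2) v(2) by argo
  qed
  have "\<exists>x. F x \<le> ereal (m + 1 / real (Suc n))" for n
  proof -
    have "(INF x. F x) < ereal (m + 1 / real (Suc n))" unfolding m by simp
    then show ?thesis unfolding INF_less_iff by (auto intro: less_imp_le)
  qed
  then obtain a where a: "\<And>n. F (a n) \<le> ereal (m + 1 / real (Suc n))" by metis
  have "Cauchy a"
  proof (rule metric_CauchyI)
    fix e :: real assume e: "e > 0"
    obtain N where N: "1 / real (Suc N) < k * e\<^sup>2"
      using e k nat_approx_posE[of "k * e\<^sup>2"] by auto
    have "dist (a i) (a j) < e" if "i \<ge> N" "j \<ge> N" for i j
    proof -
      have ij: "F (a i) \<le> ereal (m + 1 / real (Suc N))" if "i \<ge> N" for i
      proof -
        have "1 / real (Suc i) \<le> 1 / real (Suc N)" using that by (simp add: field_simps)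
        then have "ereal (m + 1 / real (Suc i)) \<le> ereal (m + 1 / real (Suc N))" by simp
        with a[of i] show ?thesis by order
      qed
      have "k * (norm (a i - a j))\<^sup>2 < k * e\<^sup>2"
        using close[OF ij[OF that(1)] ij[OF that(2)]] N by linarith
      then have "(norm (a i - a j))\<^sup>2 < e\<^sup>2" using k by simp
      then show ?thesis using e by (simp add: dist_norm power_less_imp_less_base)
    qed
    then show "\<exists>M. \<forall>i\<ge>M. \<forall>j\<ge>M. dist (a i) (a j) < e" by blast
  qed
  then obtain L where L: "a \<longlonglongrightarrow> L" using Cauchy_convergent convergent_def by blast
  have FL: "F L \<le> ereal m"
  proof (rule ccontr)
    assume "\<not> F L \<le> ereal m"
    then have "ereal m < F L" by order
    then obtain c where c: "ereal m < ereal c" "ereal c < F L"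
      using ereal_dense2 by blast
    have "eventually (\<lambda>n. ereal c < F (a n)) sequentially"
      by (rule eventually_compose_filterlim[OF lsc_fun_eventually[OF l c(2)] L])
    moreover have "eventually (\<lambda>n. 1 / real (Suc n) < c - m) sequentially"
      using c(1) LIMSEQ_inverse_real_of_nat
      by (auto simp: order_tendsto_iff inverse_eq_divide)
    ultimately have "eventually (\<lambda>n. False) sequentially"
    proof eventually_elim
      case (elim n)
      have "ereal c < ereal (m + 1 / real (Suc n))" using elim(1) a[of n] by order
      with elim(2) show ?case by simp
    qed
    then show False by simp
  qed
  show ?thesis
  proof (rule ex1I[of _ L])
    show "\<forall>z. F L \<le> F z" using FL ml by (meson order_trans)
  next
    fix y assume "\<forall>z. F y \<le> F z"
    then have "F y \<le> ereal m" using FL by (meson order_trans)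
    then have "k * (norm (y - L))\<^sup>2 \<le> 0" using close[of y 0 L] FL by simp
    then show "y = L" using k by (simp add: mult_le_0_iff)
  qed
qed

lemma is_prox_point_iff:
  "is_prox_point f x y \<longleftrightarrow>
    (\<forall>z. f y + ereal (1/2 * (norm (x - y))\<^sup>2) \<le> f z + ereal (1/2 * (norm (x - z))\<^sup>2))"
  unfolding is_prox_point_def is_arg_min_def by (auto simp: not_less)

text \<open>
  The quadratic term contributes the midpoint gain \<open>1/8 \<parallel>s - t\<parallel>\<^sup>2\<close> by the parallelogram law and
  absorbs the conical lower bound.
\<close>

lemma Gamma0_has_sprox:
  fixes f :: "'a::{real_inner,complete_space} \<Rightarrow> ereal"
  assumes f: "f \<in> Gamma0"
  shows "has_sprox f"
proof -
  have p: "proper_fun f" and l: "lsc_fun f" and c: "convex_fun f"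
    using f by (auto simp: Gamma0_def)
  have "\<exists>!y. is_prox_point f x y" for x
  proof -
    let ?F = "\<lambda>z. f z + ereal (1/2 * (norm (x - z))\<^sup>2)"
    obtain x0 a K where K: "K \<ge> 0" "\<And>y. ereal (a - K * norm (y - x0)) \<le> f y"
      by (rule Gamma0_lower_bound[OF f]) blast
    have "ereal (a - K * norm (x - x0) - K\<^sup>2 / 2) \<le> ?F z" for z
    proof -
      have "norm (z - x0) \<le> norm (x - z) + norm (x - x0)"
        by (metis norm_triangle_sub norm_minus_commute add.commute diff_add_cancel
            norm_triangle_ineq add_diff_eq)
      then have "K * norm (z - x0) \<le> K * norm (x - z) + K * norm (x - x0)"
        using K(1) by (metis distrib_left mult_left_mono)
      \<comment> \<open>Young's inequality.\<close>
      moreover have "K * norm (x - z) \<le> 1/2 * (norm (x - z))\<^sup>2 + K\<^sup>2 / 2"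
        using sum_squares_bound[of K "norm (x - z)"] by simp
      ultimately have "a - K * norm (x - x0) - K\<^sup>2 / 2
          \<le> a - K * norm (z - x0) + 1/2 * (norm (x - z))\<^sup>2" by linarith
      then show ?thesis using K(2)[of z] by (cases "f z") auto
    qed
    moreover have "proper_fun ?F" using p by (auto simp: proper_fun_def)
    moreover have "lsc_fun ?F"
      by (rule lsc_fun_add_continuous[OF l]) (intro continuous_intros)
    moreover have "?F ((1/2) *\<^sub>R s + (1/2) *\<^sub>R t)
        \<le> ereal ((u + v) / 2 - 1/8 * (norm (s - t))\<^sup>2)"
      if s: "?F s = ereal u" and t: "?F t = ereal v" for s t u v
    proof -
      obtain u' where u': "f s = ereal u'" using s by (cases "f s") auto
      obtain v' where v': "f t = ereal v'" using t by (cases "f t") auto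
      have "f ((1/2) *\<^sub>R s + (1/2) *\<^sub>R t) \<le> ereal (1/2) * f s + ereal (1/2) * f t"
        using c unfolding convex_fun_def
        by (metis field_sum_of_halves half_gt_zero_iff zero_less_one)
      then have "f ((1/2) *\<^sub>R s + (1/2) *\<^sub>R t) \<le> ereal ((u' + v') / 2)"
        using u' v' by (simp add: add_divide_distrib)
      moreover have "(norm (x - ((1/2) *\<^sub>R s + (1/2) *\<^sub>R t)))\<^sup>2
         = (norm (x - s))\<^sup>2 / 2 + (norm (x - t))\<^sup>2 / 2 - (norm (s - t))\<^sup>2 / 4"
        unfolding power2_norm_eq_inner
        by (simp add: inner_diff_left inner_diff_right inner_add_left inner_add_right
            inner_commute field_simps)
      ultimately show ?thesis using s t u' v'
        by (cases "f ((1/2) *\<^sub>R s + (1/2) *\<^sub>R t)") (auto simp: field_simps)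
    qed
    ultimately have "\<exists>!y. \<forall>z. ?F y \<le> ?F z"
      by (intro ex1_minimizer_midpoint_strongly_convex[where k = "1/8"]) auto
    then show ?thesis by (simp add: is_prox_point_iff)
  qed
  with p show ?thesis by (simp add: has_sprox_def)
qed

section \<open>Proximal points as subgradient inclusions\<close>

lemma sprox_eqI:
  assumes "is_prox_point f x y" "\<And>z. is_prox_point f x z \<Longrightarrow> z = y"
  shows "sprox f x = y"
  unfolding sprox_def using assms by (rule the_equality)

lemma is_prox_point_sprox:
  assumes "has_sprox f"
  shows "is_prox_point f x (sprox f x)"
  using assms unfolding has_sprox_def sprox_def by (blast intro: theI')

lemma prox_point_finite:
  assumes p: "proper_fun f" and x: "is_prox_point f x y"
  obtains r where "f y = ereal r"
proof -
  obtain z where z: "f z \<noteq> \<infinity>" using p by (auto simp: proper_fun_def)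
  have "f y + ereal (1/2 * (norm (x - y))\<^sup>2) \<le> f z + ereal (1/2 * (norm (x - z))\<^sup>2)"
    using x by (simp add: is_prox_point_iff)
  moreover have "f y \<noteq> -\<infinity>" using p by (auto simp: proper_fun_def)
  ultimately show ?thesis using z that by (cases "f y"; cases "f z") auto
qed

text \<open>
  Compare \<open>y\<close> with \<open>y + t (z - y)\<close>. By convexity the objective changes by at most
  \<open>t (f z - f y - (x - y) \<bullet> (z - y))\<close> plus a term of order \<open>t\<^sup>2\<close>; divide by \<open>t\<close> and let it
  tend to \<open>0\<close>.
\<close>

lemma prox_point_subgradient:
  assumes p: "proper_fun f" and c: "convex_fun f" and x: "is_prox_point f x y"
  shows "f y + ereal ((x - y) \<bullet> (z - y)) \<le> f z"
proof -
  obtain r where r: "f y = ereal r" by (rule prox_point_finite[OF p x])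
  show ?thesis
  proof (cases "f z")
    case (real w)
    have "r + (x - y) \<bullet> (z - y) \<le> w + t * ((norm (z - y))\<^sup>2 / 2)" if t: "0 < t" "t < 1" for t
    proof -
      let ?q = "(1 - t) *\<^sub>R y + t *\<^sub>R z"
      have "f ?q \<le> ereal (1 - t) * f y + ereal t * f z"
        using c t unfolding convex_fun_def by simp
      then have 1: "f ?q \<le> ereal ((1 - t) * r + t * w)" by (simp add: r real)
      have "f y + ereal (1/2 * (norm (x - y))\<^sup>2) \<le> f ?q + ereal (1/2 * (norm (x - ?q))\<^sup>2)"
        using x by (simp add: is_prox_point_iff)
      with 1 have 2: "r + 1/2 * (norm (x - y))\<^sup>2
          \<le> (1 - t) * r + t * w + 1/2 * (norm (x - ?q))\<^sup>2"
        by (cases "f ?q") (auto simp: r)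
      have "x - ?q = (x - y) - t *\<^sub>R (z - y)" by (simp add: algebra_simps)
      then have "(norm (x - ?q))\<^sup>2
          = (norm (x - y))\<^sup>2 - 2 * t * ((x - y) \<bullet> (z - y)) + t\<^sup>2 * (norm (z - y))\<^sup>2"
        by (simp only: power2_norm_eq_inner)
          (simp add: inner_diff_left inner_diff_right inner_commute power2_eq_square algebra_simps)
      with 2 have "t * (r + (x - y) \<bullet> (z - y)) \<le> t * (w + t * ((norm (z - y))\<^sup>2 / 2))"
        by (simp add: power2_eq_square algebra_simps)
      then show ?thesis using t by simp
    qed
    then have ev: "eventually (\<lambda>t. r + (x - y) \<bullet> (z - y) \<le> w + t * ((norm (z - y))\<^sup>2 / 2))
        (at_right 0)"
      unfolding eventually_at_right_field by (intro exI[of _ 1]) auto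
    have "((\<lambda>t. w + t * ((norm (z - y))\<^sup>2 / 2)) \<longlongrightarrow> w + 0 * ((norm (z - y))\<^sup>2 / 2)) (at_right 0)"
      by (intro tendsto_intros)
    from tendsto_lowerbound[OF this ev] have "r + (x - y) \<bullet> (z - y) \<le> w" by simp
    then show ?thesis by (simp add: r real)
  qed (use p in \<open>auto simp: proper_fun_def\<close>)
qed

section \<open>Completing the square\<close>

text \<open>
  The objective on the left has quadratic part \<open>(\<sigma> + \<rho>)/(2 \<sigma>) \<parallel>z\<parallel>\<^sup>2\<close> and linear part
  \<open>- x \<bullet> z\<close>. Its square is centred at \<open>\<sigma>/(\<sigma> + \<rho>) x\<close>, and taking out the factor
  \<open>(\<sigma> + \<rho>)/\<sigma>\<close> leaves the objective on the right plus a constant. Hence the two objectives differ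
  by an increasing affine map of their values, which preserves minimizers.
\<close>

lemma is_prox_point_add_quadratic:
  fixes \<phi> :: "'a::real_inner \<Rightarrow> ereal"
  assumes "\<rho> > 0" "\<sigma> > 0" and ninf: "\<And>x. \<phi> x \<noteq> -\<infinity>"
  shows "is_prox_point (\<lambda>x. add_quadratic \<rho> \<phi> x / ereal \<sigma>) x y
    \<longleftrightarrow> is_prox_point (\<lambda>x. \<phi> x / ereal (\<sigma> + \<rho>)) ((\<sigma> / (\<sigma> + \<rho>)) *\<^sub>R x) y"
proof -
  let ?F = "\<lambda>z. add_quadratic \<rho> \<phi> z / ereal \<sigma> + ereal (1/2 * (norm (x - z))\<^sup>2)"
  let ?G = "\<lambda>z. \<phi> z / ereal (\<sigma> + \<rho>) + ereal (1/2 * (norm ((\<sigma> / (\<sigma> + \<rho>)) *\<^sub>R x - z))\<^sup>2)"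
  define a where "a = (\<sigma> + \<rho>) / \<sigma>"
  define b where "b = 1/2 * (1 - \<sigma> / (\<sigma> + \<rho>)) * (norm x)\<^sup>2"
  have a: "a > 0" using assms by (simp add: a_def)
  have nz: "\<sigma> \<noteq> 0" "\<sigma> + \<rho> \<noteq> 0" using assms by auto
  have rl: "(u + \<rho> / 2 * (norm z)\<^sup>2) / \<sigma> + 1/2 * (norm (x - z))\<^sup>2
     = a * (u / (\<sigma> + \<rho>) + 1/2 * (norm ((\<sigma> / (\<sigma> + \<rho>)) *\<^sub>R x - z))\<^sup>2) + b" for u z
  proof -
    define s where "s = \<sigma> / (\<sigma> + \<rho>)"
    have as: "a * s = 1" "a / (\<sigma> + \<rho>) = 1 / \<sigma>"
      using nz by (simp_all add: a_def s_def)
    have a1: "a = 1 + \<rho> / \<sigma>" using nz by (simp add: a_def add_divide_distrib)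
    have e1: "(norm (x - z))\<^sup>2 = (norm x)\<^sup>2 - 2 * (x \<bullet> z) + (norm z)\<^sup>2"
      unfolding power2_norm_eq_inner
      by (simp add: inner_diff_left inner_diff_right inner_commute)
    have e2: "(norm (s *\<^sub>R x - z))\<^sup>2 = s * s * (norm x)\<^sup>2 - 2 * s * (x \<bullet> z) + (norm z)\<^sup>2"
      unfolding power2_norm_eq_inner
      by (simp add: inner_diff_left inner_diff_right inner_commute)
    have "a * (u / (\<sigma> + \<rho>) + 1/2 * (norm (s *\<^sub>R x - z))\<^sup>2) + b
       = u * (a / (\<sigma> + \<rho>)) + 1/2 * ((a * s) * s * (norm x)\<^sup>2 - 2 * (a * s) * (x \<bullet> z)
          + a * (norm z)\<^sup>2) + 1/2 * (1 - s) * (norm x)\<^sup>2"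
      unfolding e2 b_def s_def[symmetric] by (simp add: algebra_simps)
    also have "\<dots> = u / \<sigma> + 1/2 * ((norm x)\<^sup>2 - 2 * (x \<bullet> z) + (1 + \<rho> / \<sigma>) * (norm z)\<^sup>2)"
      unfolding as by (simp add: a1 algebra_simps diff_divide_distrib)
    also have "\<dots> = (u + \<rho> / 2 * (norm z)\<^sup>2) / \<sigma> + 1/2 * (norm (x - z))\<^sup>2"
      unfolding e1 by (simp add: algebra_simps add_divide_distrib)
    finally show ?thesis unfolding s_def by simp
  qed
  have FG: "?F z = ereal a * ?G z + ereal b" for z
  proof (cases "\<phi> z")
    case (real u)
    then show ?thesis using rl[of u z] nz by (simp add: add_quadratic_def)
  next
    case PInf
    then show ?thesis using assms a by (simp add: add_quadratic_def)
  qed (use ninf in auto)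
  have "?F y \<le> ?F z \<longleftrightarrow> ?G y \<le> ?G z" for z
    unfolding FG using a by (cases "?G y"; cases "?G z") auto
  then show ?thesis unfolding is_prox_point_iff by simp
qed

section \<open>Moreau's decomposition\<close>

text \<open>
  The proximal point \<open>p\<close> yields the subgradient \<open>q = x - \<sigma> p\<close> of \<open>g\<close> at \<open>p\<close>, hence equality in
  the Fenchel--Young inequality at the pair \<open>(p, q)\<close>. At any other point \<open>z\<close> the inequality bounds
  the conjugate below by \<open>z \<bullet> p - g p\<close>. Since \<open>x - q = \<sigma> p\<close>, the linear terms in \<open>z - q\<close>
  cancel in the proximal objective of the scaled conjugate, which therefore exceeds its value at
  \<open>q\<close> by at least \<open>1/2 \<parallel>z - q\<parallel>\<^sup>2\<close>.
\<close>

lemma prox_point_fenchel_conjugate: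
  fixes g :: "'a::{real_inner,complete_space} \<Rightarrow> ereal"
  assumes g: "g \<in> Gamma0" and s: "\<sigma> > 0"
    and pt: "is_prox_point (\<lambda>x. g x / ereal \<sigma>) ((1 / \<sigma>) *\<^sub>R x) p"
  shows "is_prox_point (\<lambda>y. ereal \<sigma> * fenchel_conjugate g y) x (x - \<sigma> *\<^sub>R p)"
    and "is_prox_point (\<lambda>y. ereal \<sigma> * fenchel_conjugate g y) x z \<Longrightarrow> z = x - \<sigma> *\<^sub>R p"
    and "proper_fun (\<lambda>y. ereal \<sigma> * fenchel_conjugate g y)"
proof -
  define q where "q = x - \<sigma> *\<^sub>R p"
  have g': "(\<lambda>x. g x / ereal \<sigma>) \<in> Gamma0" by (rule Gamma0_divide[OF g s])
  then have pr: "proper_fun (\<lambda>x. g x / ereal \<sigma>)" and c: "convex_fun (\<lambda>x. g x / ereal \<sigma>)"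
    by (auto simp: Gamma0_def)
  obtain r' where r': "g p / ereal \<sigma> = ereal r'" by (rule prox_point_finite[OF pr pt])
  then obtain r where r: "g p = ereal r" using s by (cases "g p") auto
  have sub: "ereal (r + q \<bullet> (y - p)) \<le> g y" for y
  proof -
    have *: "g p / ereal \<sigma> + ereal (((1 / \<sigma>) *\<^sub>R x - p) \<bullet> (y - p)) \<le> g y / ereal \<sigma>"
      by (rule prox_point_subgradient[OF pr c pt])
    have "(1 / \<sigma>) *\<^sub>R x - p = (1 / \<sigma>) *\<^sub>R q" using s by (simp add: q_def scaleR_diff_right)
    then have "((1 / \<sigma>) *\<^sub>R x - p) \<bullet> (y - p) = (q \<bullet> (y - p)) / \<sigma>" by simp
    with * show ?thesis using s r
      by (cases "g y") (auto simp: add_divide_distrib[symmetric] divide_le_cancel)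
  qed
  have lo: "ereal (z \<bullet> p - r) \<le> fenchel_conjugate g z" for z
  proof -
    have "ereal (z \<bullet> p) - g p \<le> fenchel_conjugate g z"
      unfolding fenchel_conjugate_def by (rule SUP_upper) simp
    then show ?thesis by (simp add: r)
  qed
  have up: "fenchel_conjugate g q \<le> ereal (q \<bullet> p - r)"
    unfolding fenchel_conjugate_def
  proof (rule SUP_least)
    fix y
    show "ereal (q \<bullet> y) - g y \<le> ereal (q \<bullet> p - r)"
      using sub[of y] by (cases "g y") (auto simp: inner_diff_right)
  qed
  have eq: "fenchel_conjugate g q = ereal (q \<bullet> p - r)" using lo up by (intro antisym)
  have grow: "ereal (\<sigma> * (q \<bullet> p - r) + 1/2 * (norm (x - q))\<^sup>2 + 1/2 * (norm (z - q))\<^sup>2)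
      \<le> ereal \<sigma> * fenchel_conjugate g z + ereal (1/2 * (norm (x - z))\<^sup>2)" for z
  proof -
    have "x - z = \<sigma> *\<^sub>R p - (z - q)" "x - q = \<sigma> *\<^sub>R p" by (auto simp: q_def)
    then have "(norm (x - z))\<^sup>2 = (norm (x - q))\<^sup>2 - 2 * \<sigma> * (p \<bullet> (z - q)) + (norm (z - q))\<^sup>2"
      by (simp only: power2_norm_eq_inner)
        (simp add: inner_diff_left inner_diff_right inner_commute algebra_simps)
    then have "\<sigma> * (q \<bullet> p - r) + 1/2 * (norm (x - q))\<^sup>2 + 1/2 * (norm (z - q))\<^sup>2
        = \<sigma> * (z \<bullet> p - r) + 1/2 * (norm (x - z))\<^sup>2"
      by (simp add: inner_diff_right inner_commute algebra_simps)
    moreover have "ereal (\<sigma> * (z \<bullet> p - r)) \<le> ereal \<sigma> * fenchel_conjugate g z"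
      using lo[of z] s by (cases "fenchel_conjugate g z") auto
    ultimately show ?thesis by (metis add_right_mono plus_ereal.simps(1))
  qed
  show pt': "is_prox_point (\<lambda>y. ereal \<sigma> * fenchel_conjugate g y) x (x - \<sigma> *\<^sub>R p)"
    unfolding is_prox_point_iff q_def[symmetric]
  proof
    fix z
    have "ereal \<sigma> * fenchel_conjugate g q + ereal (1/2 * (norm (x - q))\<^sup>2)
      \<le> ereal (\<sigma> * (q \<bullet> p - r) + 1/2 * (norm (x - q))\<^sup>2 + 1/2 * (norm (z - q))\<^sup>2)"
      by (simp add: eq)
    also note grow
    finally show "ereal \<sigma> * fenchel_conjugate g q + ereal (1/2 * (norm (x - q))\<^sup>2)
      \<le> ereal \<sigma> * fenchel_conjugate g z + ereal (1/2 * (norm (x - z))\<^sup>2)" .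
  qed
  show "z = x - \<sigma> *\<^sub>R p"
    if "is_prox_point (\<lambda>y. ereal \<sigma> * fenchel_conjugate g y) x z"
  proof -
    have "ereal \<sigma> * fenchel_conjugate g z + ereal (1/2 * (norm (x - z))\<^sup>2)
      \<le> ereal \<sigma> * fenchel_conjugate g q + ereal (1/2 * (norm (x - q))\<^sup>2)"
      using that by (simp add: is_prox_point_iff)
    with grow[of z] have "ereal (\<sigma> * (q \<bullet> p - r) + 1/2 * (norm (x - q))\<^sup>2 + 1/2 * (norm (z - q))\<^sup>2)
      \<le> ereal (\<sigma> * (q \<bullet> p - r) + 1/2 * (norm (x - q))\<^sup>2)"
      by (simp add: eq del: ereal_less_eq)
    then show ?thesis by (simp add: q_def)
  qed
  show "proper_fun (\<lambda>y. ereal \<sigma> * fenchel_conjugate g y)"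
    unfolding proper_fun_def
  proof (intro conjI allI exI)
    fix y
    show "ereal \<sigma> * fenchel_conjugate g y \<noteq> -\<infinity>"
      using lo[of y] s by (cases "fenchel_conjugate g y") auto
    show "ereal \<sigma> * fenchel_conjugate g q \<noteq> \<infinity>" by (simp add: eq)
  qed
qed

section \<open>The two identities\<close>

theorem proposition3:
  fixes \<phi> :: "'a::{real_inner,complete_space} \<Rightarrow> ereal"
    and \<rho> \<sigma> :: real
  assumes "\<rho> > 0"
    and "\<forall>x. \<phi> x \<noteq> -\<infinity>"
    and "add_quadratic \<rho> \<phi> \<in> Gamma0"
    and "\<sigma> > 0"
  shows "has_sprox (\<lambda>x. add_quadratic \<rho> \<phi> x / ereal \<sigma>)
    \<and> has_sprox (\<lambda>x. \<phi> x / ereal (\<sigma> + \<rho>))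
    \<and> has_sprox (\<lambda>x. ereal \<sigma> * fenchel_conjugate (add_quadratic \<rho> \<phi>) x)
    \<and> sprox (\<lambda>x. add_quadratic \<rho> \<phi> x / ereal \<sigma>)
        = sprox (\<lambda>x. \<phi> x / ereal (\<sigma> + \<rho>)) \<circ> (\<lambda>x. (\<sigma> / (\<sigma> + \<rho>)) *\<^sub>R x)
    \<and> id = (\<lambda>x. sprox (\<lambda>y. ereal \<sigma> * fenchel_conjugate (add_quadratic \<rho> \<phi>) y) x
              + \<sigma> *\<^sub>R (sprox (\<lambda>y. \<phi> y / ereal (\<sigma> + \<rho>)) \<circ> (\<lambda>z. inverse (\<sigma> + \<rho>) *\<^sub>R z)) x)"
proof -
  let ?f = "\<lambda>x. add_quadratic \<rho> \<phi> x / ereal \<sigma>"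
  let ?h = "\<lambda>x. \<phi> x / ereal (\<sigma> + \<rho>)"
  let ?c = "\<lambda>x. ereal \<sigma> * fenchel_conjugate (add_quadratic \<rho> \<phi>) x"
  have f: "has_sprox ?f" by (intro Gamma0_has_sprox Gamma0_divide assms)
  have tr: "is_prox_point ?f x y \<longleftrightarrow> is_prox_point ?h ((\<sigma> / (\<sigma> + \<rho>)) *\<^sub>R x) y" for x y
    using assms by (intro is_prox_point_add_quadratic) auto
  have "\<exists>!y. is_prox_point ?h x y" for x
  proof -
    have "\<exists>!y. is_prox_point ?f (((\<sigma> + \<rho>) / \<sigma>) *\<^sub>R x) y"
      using f by (simp add: has_sprox_def)
    then show ?thesis unfolding tr using assms(1,4) by simp
  qed
  moreover have "proper_fun ?h"
  proof -
    obtain x0 where "add_quadratic \<rho> \<phi> x0 \<noteq> \<infinity>"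
      using assms(3) by (auto simp: Gamma0_def proper_fun_def)
    then have "\<phi> x0 \<noteq> \<infinity>" by (auto simp: add_quadratic_def)
    then show ?thesis using assms(1,2,4)
      by (auto simp: proper_fun_def divide_ereal_def ereal_mult_eq_MInfty ereal_mult_eq_PInfty)
  qed
  ultimately have h: "has_sprox ?h" by (simp add: has_sprox_def)
  have fh: "sprox ?f x = sprox ?h ((\<sigma> / (\<sigma> + \<rho>)) *\<^sub>R x)" for x
    unfolding sprox_def tr ..
  note moreau = prox_point_fenchel_conjugate[OF assms(3,4) is_prox_point_sprox[OF f]]
  have c: "has_sprox ?c"
    unfolding has_sprox_def using moreau by blast
  have cs: "sprox ?c x = x - \<sigma> *\<^sub>R sprox ?f ((1 / \<sigma>) *\<^sub>R x)" for x
    by (rule sprox_eqI) (rule moreau(1), erule moreau(2))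
  have "sprox ?c x + \<sigma> *\<^sub>R sprox ?h (inverse (\<sigma> + \<rho>) *\<^sub>R x) = x" for x
    unfolding cs fh using assms(4) by (simp add: inverse_eq_divide)
  with f h c fh show ?thesis by (auto simp: fun_eq_iff)
qed

end
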